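(* Let $(M,\varphi,\xi,\eta,g)$ be an almost contact B-metric manifold carrying a regular torse-forming constant-length vertical vector field $\vartheta$. Then every symmetric second-order covariant tensor (i.e. symmetric $(0,2)$-tensor field) $h$ on $M$ that is parallel with respect to the Levi-Civita connection $\nabla$ of the B-metric $g$ is a constant multiple of $g$.
   Context: An almost contact B-metric manifold $(M,\varphi,\xi,\eta,g)$ is a smooth manifold $M$ of dimension $2n+1$ ($n\ge 1$) with an endomorphism $\varphi$ of $TM$, a vector field $\xi$ (the Reeb vector field), a 1-form $\eta$, and a pseudo-Riemannian metric $g$ (the B-metric) of signature $(n+1,n)$ such that $$\varphi\xi=0,\quad \varphi^2=-\mathrm{id}+\eta\otimes\xi,\quad \eta\circ\varphi=0,\quad \eta(\xi)=1,\quad g(\varphi x,\varphi y)=-g(x,y)+\eta(x)\eta(y)$$ for all $x,y$. A vector field $\vartheta$ is torse-forming if $\nabla_x\vartheta=f\,x+\gamma(x)\vartheta$ for all $x$, where $f$ is a differentiable function (the conformal scalar) and $\gamma$ is a 1-form (the generating form). The trivial case $f=0$ (identically) is excluded. It is constant-length vertical if $\vartheta=k\,\xi$ with $k$ a nonzero constant (the constant of proportionality to $\xi$). A torse-forming constant-length vertical vector field $\vartheta$ is regular if $k\,\mathrm{d}f(\xi)+f^2\neq0$ (at every point of $M$).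
   Formalization: The manifold M is assumed connected; otherwise the claim fails, since a parallel symmetric tensor h may equal g on one component and 2g on another. *)

theory Defs
  imports "HOL-Analysis.Analysis"
begin

section \<open>Smooth maps between Euclidean spaces\<close>

text \<open>
  All iterated directional derivatives exist and are continuous. The notion is only
  meaningful for open sets \<open>S\<close>, and is only used for such.
\<close>

primrec Ck_on :: "nat \<Rightarrow> 'e::euclidean_space set \<Rightarrow> ('e \<Rightarrow> 'b::real_normed_vector) \<Rightarrow> bool" where
  "Ck_on 0 S f \<longleftrightarrow> continuous_on S f"
| "Ck_on (Suc k) S f \<longleftrightarrow>
     (\<forall>x\<in>S. f differentiable (at x)) \<and>
     (\<forall>v. Ck_on k S (\<lambda>x. frechet_derivative f (at x) v))"

definition smooth_on :: "'e::euclidean_space set \<Rightarrow> ('e \<Rightarrow> 'b::real_normed_vector) \<Rightarrow> bool" where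
  "smooth_on S f \<longleftrightarrow> (\<forall>k. Ck_on k S f)"


section \<open>Smooth manifolds\<close>

text \<open>
  The point set of the manifold is a whole type \<open>'a\<close> (Hausdorff and second countable by its
  type class); the smooth structure is an atlas of charts, pairs of a domain and a coordinate
  map, with values in a Euclidean space \<open>'e\<close>, whose dimension is the dimension of the manifold.
\<close>

type_synonym ('a, 'e) chart = "'a set \<times> ('a \<Rightarrow> 'e)"
type_synonym ('a, 'e) atlas = "('a, 'e) chart set"

definition inv_chart :: "('a, 'e) chart \<Rightarrow> 'e \<Rightarrow> 'a" where
  "inv_chart c = inv_into (fst c) (snd c)"

definition chart_image :: "('a, 'e) chart \<Rightarrow> 'e set" where
  "chart_image c = snd c ` fst c"

definition is_chart :: "('a::topological_space, 'e::euclidean_space) chart \<Rightarrow> bool" where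
  "is_chart c \<longleftrightarrow>
     open (fst c) \<and> open (chart_image c) \<and>
     homeomorphism (fst c) (chart_image c) (snd c) (inv_chart c)"

definition smooth_atlas ::
  "('a::{t2_space, second_countable_topology}, 'e::euclidean_space) atlas \<Rightarrow> bool" where
  "smooth_atlas A \<longleftrightarrow>
     (\<forall>c\<in>A. is_chart c) \<and> (\<Union>c\<in>A. fst c) = UNIV \<and>
     (\<forall>c\<in>A. \<forall>d\<in>A. smooth_on (snd c ` (fst c \<inter> fst d)) (snd d \<circ> inv_chart c))"

definition smooth_fun :: "('a, 'e::euclidean_space) atlas \<Rightarrow> ('a \<Rightarrow> real) \<Rightarrow> bool" where
  "smooth_fun A f \<longleftrightarrow> (\<forall>c\<in>A. smooth_on (chart_image c) (f \<circ> inv_chart c))"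


section \<open>Tangent vectors and tensor fields\<close>

text \<open>
  Every tangent space \<open>T\<^sub>p M\<close> is identified with the model space \<open>'e\<close> by means of one chart
  \<open>chart_at A p\<close> around \<open>p\<close>, chosen once and for all: \<open>v :: 'e\<close> stands for the tangent vector at
  \<open>p\<close> with components \<open>v\<close> in that chart. The choice varies with \<open>p\<close> without any regularity, so
  smoothness of a field \<open>X :: 'a \<Rightarrow> 'e\<close> is not smoothness of \<open>X\<close> as a function; one
  first has to pass to the components of \<open>X p\<close> in a fixed chart (\<open>components\<close> below).
\<close>

definition chart_at :: "('a, 'e) atlas \<Rightarrow> 'a \<Rightarrow> ('a, 'e) chart" where
  "chart_at A p = (SOME c. c \<in> A \<and> p \<in> fst c)"

definition components ::
  "('a, 'e::euclidean_space) atlas \<Rightarrow> ('a, 'e) chart \<Rightarrow> 'a \<Rightarrow> 'e \<Rightarrow> 'e" where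
  "components A c p v =
     frechet_derivative (snd c \<circ> inv_chart (chart_at A p)) (at (snd (chart_at A p) p)) v"

definition differential ::
  "('a, 'e::euclidean_space) atlas \<Rightarrow> ('a \<Rightarrow> real) \<Rightarrow> 'a \<Rightarrow> 'e \<Rightarrow> real" where
  "differential A f p v =
     frechet_derivative (f \<circ> inv_chart (chart_at A p)) (at (snd (chart_at A p) p)) v"

definition vector_field :: "('a, 'e::euclidean_space) atlas \<Rightarrow> ('a \<Rightarrow> 'e) \<Rightarrow> bool" where
  "vector_field A X \<longleftrightarrow>
     (\<forall>c\<in>A. smooth_on (chart_image c) ((\<lambda>p. components A c p (X p)) \<circ> inv_chart c))"

definition one_form :: "('a, 'e::euclidean_space) atlas \<Rightarrow> ('a \<Rightarrow> 'e \<Rightarrow> real) \<Rightarrow> bool" where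
  "one_form A \<omega> \<longleftrightarrow>
     (\<forall>p. linear (\<omega> p)) \<and>
     (\<forall>X. vector_field A X \<longrightarrow> smooth_fun A (\<lambda>p. \<omega> p (X p)))"

definition endomorphism_field :: "('a, 'e::euclidean_space) atlas \<Rightarrow> ('a \<Rightarrow> 'e \<Rightarrow> 'e) \<Rightarrow> bool" where
  "endomorphism_field A \<phi> \<longleftrightarrow>
     (\<forall>p. linear (\<phi> p)) \<and>
     (\<forall>X. vector_field A X \<longrightarrow> vector_field A (\<lambda>p. \<phi> p (X p)))"

definition tensor_field_02 ::
  "('a, 'e::euclidean_space) atlas \<Rightarrow> ('a \<Rightarrow> 'e \<Rightarrow> 'e \<Rightarrow> real) \<Rightarrow> bool" where
  "tensor_field_02 A h \<longleftrightarrow>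
     (\<forall>p. bilinear (h p)) \<and>
     (\<forall>X Y. vector_field A X \<and> vector_field A Y \<longrightarrow> smooth_fun A (\<lambda>p. h p (X p) (Y p)))"

definition symmetric_02 :: "('a \<Rightarrow> 'e \<Rightarrow> 'e \<Rightarrow> real) \<Rightarrow> bool" where
  "symmetric_02 h \<longleftrightarrow> (\<forall>p u v. h p u v = h p v u)"


section \<open>Pseudo-Riemannian metrics and the Levi-Civita connection\<close>

definition has_signature :: "('e::euclidean_space \<Rightarrow> 'e \<Rightarrow> real) \<Rightarrow> nat \<Rightarrow> nat \<Rightarrow> bool" where
  "has_signature b r s \<longleftrightarrow>
     (\<exists>P N. P \<inter> N = {} \<and> independent (P \<union> N) \<and> span (P \<union> N) = UNIV \<and>
            card P = r \<and> card N = s \<and>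
            (\<forall>u\<in>P \<union> N. \<forall>v\<in>P \<union> N. u \<noteq> v \<longrightarrow> b u v = 0) \<and>
            (\<forall>u\<in>P. b u u = 1) \<and> (\<forall>u\<in>N. b u u = -1))"

definition pseudo_riemannian_metric ::
  "('a, 'e::euclidean_space) atlas \<Rightarrow> ('a \<Rightarrow> 'e \<Rightarrow> 'e \<Rightarrow> real) \<Rightarrow> nat \<Rightarrow> nat \<Rightarrow> bool" where
  "pseudo_riemannian_metric A g r s \<longleftrightarrow>
     tensor_field_02 A g \<and> symmetric_02 g \<and> (\<forall>p. has_signature (g p) r s)"

text \<open>
  A connection is an operator on smooth vector fields, \<open>nabla X Y\<close> being
  \<open>\<nabla>\<^bsub>X\<^esub> Y\<close>; its values on non-smooth arguments are arbitrary and never used.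
\<close>

definition connection ::
  "('a, 'e::euclidean_space) atlas \<Rightarrow> (('a \<Rightarrow> 'e) \<Rightarrow> ('a \<Rightarrow> 'e) \<Rightarrow> 'a \<Rightarrow> 'e) \<Rightarrow> bool" where
  "connection A nabla \<longleftrightarrow>
     (\<forall>X Y. vector_field A X \<and> vector_field A Y \<longrightarrow> vector_field A (nabla X Y)) \<and>
     (\<forall>X Y Z. vector_field A X \<and> vector_field A Y \<and> vector_field A Z \<longrightarrow>
        (\<forall>p. nabla (\<lambda>q. X q + Y q) Z p = nabla X Z p + nabla Y Z p) \<and>
        (\<forall>p. nabla X (\<lambda>q. Y q + Z q) p = nabla X Y p + nabla X Z p)) \<and>
     (\<forall>f X Y. smooth_fun A f \<and> vector_field A X \<and> vector_field A Y \<longrightarrow>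
        (\<forall>p. nabla (\<lambda>q. f q *\<^sub>R X q) Y p = f p *\<^sub>R nabla X Y p) \<and>
        (\<forall>p. nabla X (\<lambda>q. f q *\<^sub>R Y q) p =
               differential A f p (X p) *\<^sub>R Y p + f p *\<^sub>R nabla X Y p))"

text \<open>\<open>Z = [X, Y]\<close>, that is, \<open>Z f = X (Y f) - Y (X f)\<close> for all smooth functions \<open>f\<close>.\<close>

definition is_lie_bracket ::
  "('a, 'e::euclidean_space) atlas \<Rightarrow> ('a \<Rightarrow> 'e) \<Rightarrow> ('a \<Rightarrow> 'e) \<Rightarrow> ('a \<Rightarrow> 'e) \<Rightarrow> bool" where
  "is_lie_bracket A X Y Z \<longleftrightarrow>
     vector_field A Z \<and>
     (\<forall>f. smooth_fun A f \<longrightarrow>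
       (\<forall>p. differential A f p (Z p) =
              differential A (\<lambda>q. differential A f q (Y q)) p (X p) -
              differential A (\<lambda>q. differential A f q (X q)) p (Y p)))"

definition torsion_free ::
  "('a, 'e::euclidean_space) atlas \<Rightarrow> (('a \<Rightarrow> 'e) \<Rightarrow> ('a \<Rightarrow> 'e) \<Rightarrow> 'a \<Rightarrow> 'e) \<Rightarrow> bool" where
  "torsion_free A nabla \<longleftrightarrow>
     (\<forall>X Y. vector_field A X \<and> vector_field A Y \<longrightarrow>
        is_lie_bracket A X Y (\<lambda>p. nabla X Y p - nabla Y X p))"

definition covariant_derivative_02 ::
  "('a, 'e::euclidean_space) atlas \<Rightarrow> (('a \<Rightarrow> 'e) \<Rightarrow> ('a \<Rightarrow> 'e) \<Rightarrow> 'a \<Rightarrow> 'e) \<Rightarrow>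
   ('a \<Rightarrow> 'e \<Rightarrow> 'e \<Rightarrow> real) \<Rightarrow> ('a \<Rightarrow> 'e) \<Rightarrow> ('a \<Rightarrow> 'e) \<Rightarrow> ('a \<Rightarrow> 'e) \<Rightarrow> 'a \<Rightarrow> real" where
  "covariant_derivative_02 A nabla h X Y Z p =
     differential A (\<lambda>q. h q (Y q) (Z q)) p (X p)
       - h p (nabla X Y p) (Z p) - h p (Y p) (nabla X Z p)"

definition parallel_02 ::
  "('a, 'e::euclidean_space) atlas \<Rightarrow> (('a \<Rightarrow> 'e) \<Rightarrow> ('a \<Rightarrow> 'e) \<Rightarrow> 'a \<Rightarrow> 'e) \<Rightarrow>
   ('a \<Rightarrow> 'e \<Rightarrow> 'e \<Rightarrow> real) \<Rightarrow> bool" where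
  "parallel_02 A nabla h \<longleftrightarrow>
     (\<forall>X Y Z. vector_field A X \<and> vector_field A Y \<and> vector_field A Z \<longrightarrow>
        (\<forall>p. covariant_derivative_02 A nabla h X Y Z p = 0))"

definition levi_civita ::
  "('a, 'e::euclidean_space) atlas \<Rightarrow> ('a \<Rightarrow> 'e \<Rightarrow> 'e \<Rightarrow> real) \<Rightarrow>
   (('a \<Rightarrow> 'e) \<Rightarrow> ('a \<Rightarrow> 'e) \<Rightarrow> 'a \<Rightarrow> 'e) \<Rightarrow> bool" where
  "levi_civita A g nabla \<longleftrightarrow>
     connection A nabla \<and> torsion_free A nabla \<and> parallel_02 A nabla g"


section \<open>Almost contact B-metric manifolds and torse-forming vector fields\<close>

definition almost_contact_B_metric_manifold ::
  "('a::{t2_space, second_countable_topology}, 'e::euclidean_space) atlas \<Rightarrow> nat \<Rightarrow>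
   ('a \<Rightarrow> 'e \<Rightarrow> 'e) \<Rightarrow> ('a \<Rightarrow> 'e) \<Rightarrow> ('a \<Rightarrow> 'e \<Rightarrow> real) \<Rightarrow>
   ('a \<Rightarrow> 'e \<Rightarrow> 'e \<Rightarrow> real) \<Rightarrow> bool" where
  "almost_contact_B_metric_manifold A n \<phi> \<xi> \<eta> g \<longleftrightarrow>
     smooth_atlas A \<and> n \<ge> 1 \<and> DIM('e) = 2 * n + 1 \<and>
     endomorphism_field A \<phi> \<and> vector_field A \<xi> \<and> one_form A \<eta> \<and>
     pseudo_riemannian_metric A g (n + 1) n \<and>
     (\<forall>p. \<phi> p (\<xi> p) = 0) \<and>
     (\<forall>p u. \<phi> p (\<phi> p u) = - u + \<eta> p u *\<^sub>R \<xi> p) \<and>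
     (\<forall>p u. \<eta> p (\<phi> p u) = 0) \<and>
     (\<forall>p. \<eta> p (\<xi> p) = 1) \<and>
     (\<forall>p u v. g p (\<phi> p u) (\<phi> p v) = - g p u v + \<eta> p u * \<eta> p v)"

definition torse_forming ::
  "('a, 'e::euclidean_space) atlas \<Rightarrow> (('a \<Rightarrow> 'e) \<Rightarrow> ('a \<Rightarrow> 'e) \<Rightarrow> 'a \<Rightarrow> 'e) \<Rightarrow>
   ('a \<Rightarrow> 'e) \<Rightarrow> ('a \<Rightarrow> real) \<Rightarrow> ('a \<Rightarrow> 'e \<Rightarrow> real) \<Rightarrow> bool" where
  "torse_forming A nabla \<theta> f \<gamma> \<longleftrightarrow>
     vector_field A \<theta> \<and> smooth_fun A f \<and> one_form A \<gamma> \<and> (\<exists>p. f p \<noteq> 0) \<and>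
     (\<forall>X. vector_field A X \<longrightarrow>
        (\<forall>p. nabla X \<theta> p = f p *\<^sub>R X p + \<gamma> p (X p) *\<^sub>R \<theta> p))"

definition constant_length_vertical ::
  "('a \<Rightarrow> 'e::real_vector) \<Rightarrow> ('a \<Rightarrow> 'e) \<Rightarrow> real \<Rightarrow> bool" where
  "constant_length_vertical \<xi> \<theta> k \<longleftrightarrow> k \<noteq> 0 \<and> (\<forall>p. \<theta> p = k *\<^sub>R \<xi> p)"

definition regular_tf ::
  "('a, 'e::euclidean_space) atlas \<Rightarrow> ('a \<Rightarrow> 'e) \<Rightarrow> ('a \<Rightarrow> real) \<Rightarrow> real \<Rightarrow> bool" where
  "regular_tf A \<xi> f k \<longleftrightarrow> (\<forall>p. k * differential A f p (\<xi> p) + (f p)\<^sup>2 \<noteq> 0)"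

end

theory Submission
  imports Defs
begin

text \<open>
  The vertical field \<open>\<theta> = k \<xi>\<close> enters through two properties: its length \<open>N = g(\<theta>, \<theta>) = k\<^sup>2\<close> is a
  nonzero constant, and \<open>\<theta>(f) + f\<^sup>2\<close> vanishes nowhere. Write \<open>s = h(\<theta>, \<theta>)\<close> and consider the
  1-form \<open>B(Y) = N h(Y, \<theta>) - s g(Y, \<theta>)\<close>, which measures how far \<open>h(\<cdot>, \<theta>)\<close> is from being
  proportional to \<open>g(\<cdot>, \<theta>)\<close>. Constant length determines the generating form,
  \<open>N \<gamma> = - f g(\<cdot>, \<theta>)\<close>, so that \<open>\<nabla>\<^bsub>\<theta>\<^esub> \<theta> = 0\<close>, and since \<open>h\<close> is parallel, \<open>N ds = 2 f B\<close>.

  In place of the curvature identity \<open>h(R(x,y)z, w) + h(z, R(x,y)w) = 0\<close>, the proof uses the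
  symmetry of second derivatives of the single function \<open>s\<close>. As \<open>\<theta>(s) = 0\<close>, we have
  \<open>[\<theta>, Y] s = \<theta>(Y s)\<close> for every vector field \<open>Y\<close>. Writing
  \<open>[\<theta>, Y] = \<nabla>\<^bsub>\<theta>\<^esub> Y - \<nabla>\<^bsub>Y\<^esub> \<theta>\<close> and using \<open>N ds = 2 f B\<close> on both sides, the terms with
  \<open>B(\<nabla>\<^bsub>\<theta>\<^esub> Y)\<close> cancel and there remains \<open>(\<theta>(f) + f\<^sup>2) B(Y) = 0\<close>. Regularity gives
  \<open>B = 0\<close>; hence \<open>ds = 0\<close>, and \<open>s\<close> is constant because \<open>M\<close> is connected.

  Differentiating \<open>B = 0\<close> along \<open>X\<close> gives \<open>f (N h - s g) = 0\<close>. Where \<open>f\<close> does not vanish, this is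
  the claim with the constant \<open>s / N\<close>. Where \<open>f\<close> vanishes, differentiating once more along \<open>\<theta>\<close>
  gives \<open>\<theta>(f) (N h - s g) = 0\<close>, and there \<open>\<theta>(f) \<noteq> 0\<close> by regularity. This is
  \<open>parallel_tensor_multiple_of_metric\<close>.

  Since the connection acts on globally defined smooth fields, passing to pointwise
  statements requires that every tangent vector extend to such a field
  (\<open>vector_field_extension\<close>). This is done with a bump function in a chart, and needs the
  elementary calculus of smooth maps: sums, products, composition, and gluing along open sets.
\<close>

section \<open>Closure properties of smooth maps\<close>

lemma frechet_derivative_cong_open:
  assumes "open S" "x \<in> S" "\<And>y. y \<in> S \<Longrightarrow> f y = g y"
  shows "frechet_derivative f (at x) = frechet_derivative g (at x)"
proof -
  have "(f has_derivative D) (at x) \<longleftrightarrow> (g has_derivative D) (at x)" for D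
    using has_derivative_transform_within_open[OF _ assms(1,2), of f D UNIV g]
      has_derivative_transform_within_open[OF _ assms(1,2), of g D UNIV f] assms(3)
    by auto
  then show ?thesis
    by (simp add: frechet_derivative_def)
qed

lemma differentiable_cong_open:
  assumes "open S" "x \<in> S" "\<And>y. y \<in> S \<Longrightarrow> f y = g y" "f differentiable (at x)"
  shows "g differentiable (at x)"
  using assms has_derivative_transform_within_open[OF _ assms(1,2), of f _ UNIV g]
  unfolding differentiable_def by blast

lemma Ck_on_cong:
  assumes "open S" "\<And>x. x \<in> S \<Longrightarrow> f x = g x" "Ck_on k S f"
  shows "Ck_on k S g"
  using assms(2,3)
proof (induction k arbitrary: f g)
  case 0
  then show ?case by (simp cong: continuous_on_cong)
next
  case (Suc k)
  have "g differentiable (at x)" if "x \<in> S" for x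
    using differentiable_cong_open[OF assms(1) that, of f g] Suc.prems that by simp
  moreover have "Ck_on k S (\<lambda>x. frechet_derivative g (at x) v)" for v
  proof (rule Suc.IH)
    show "Ck_on k S (\<lambda>x. frechet_derivative f (at x) v)"
      using Suc.prems by simp
    show "frechet_derivative f (at x) v = frechet_derivative g (at x) v" if "x \<in> S" for x
      using frechet_derivative_cong_open[OF assms(1) that, of f g] Suc.prems by simp
  qed
  ultimately show ?case by simp
qed

lemma Ck_on_subset:
  assumes "Ck_on k S f" "T \<subseteq> S"
  shows "Ck_on k T f"
  using assms by (induction k arbitrary: f) (auto intro: continuous_on_subset)

lemma Ck_on_SucD:
  assumes "Ck_on (Suc k) S f"
  shows "Ck_on k S f"
  using assms
proof (induction k arbitrary: f)
  case 0
  then show ?case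
    by (auto intro!: continuous_at_imp_continuous_on differentiable_imp_continuous_within)
next
  case (Suc k)
  then show ?case by (metis Ck_on.simps(2))
qed

lemma Ck_on_Un:
  assumes "open S" "open T" "Ck_on k S f" "Ck_on k T f"
  shows "Ck_on k (S \<union> T) f"
  using assms by (induction k arbitrary: f) (auto intro: continuous_on_open_Un)

lemma Ck_on_const: "Ck_on k S (\<lambda>x. c)"
  by (induction k arbitrary: c) (auto simp: frechet_derivative_const)

lemma Ck_on_add:
  assumes "open S" "Ck_on k S f" "Ck_on k S g"
  shows "Ck_on k S (\<lambda>x. f x + g x)"
  using assms(2,3)
proof (induction k arbitrary: f g)
  case 0
  then show ?case by (auto intro: continuous_on_add)
next
  case (Suc k)
  have D: "((\<lambda>x. f x + g x) has_derivative
      (\<lambda>v. frechet_derivative f (at x) v + frechet_derivative g (at x) v)) (at x)"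
    if "x \<in> S" for x
    using Suc.prems that by (auto intro!: has_derivative_add simp: frechet_derivative_works[symmetric])
  have "Ck_on k S (\<lambda>x. frechet_derivative (\<lambda>x. f x + g x) (at x) v)" for v
  proof (rule Ck_on_cong[OF assms(1)])
    show "Ck_on k S (\<lambda>x. frechet_derivative f (at x) v + frechet_derivative g (at x) v)"
      using Suc by auto
    show "frechet_derivative f (at x) v + frechet_derivative g (at x) v =
      frechet_derivative (\<lambda>x. f x + g x) (at x) v" if "x \<in> S" for x
      using frechet_derivative_at[OF D[OF that]] by metis
  qed
  then show ?case using D by (auto simp: differentiable_def)
qed

lemma Ck_on_sum:
  assumes "open S" "finite I" "\<And>i. i \<in> I \<Longrightarrow> Ck_on k S (f i)"
  shows "Ck_on k S (\<lambda>x. \<Sum>i\<in>I. f i x)"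
  using assms(2,3)
  by (induction I rule: finite_induct) (auto intro: Ck_on_const Ck_on_add assms(1))

lemma Ck_on_bilinear:
  assumes "bounded_bilinear mul" "open S" "Ck_on k S f" "Ck_on k S g"
  shows "Ck_on k S (\<lambda>x. mul (f x) (g x))"
  using assms(3,4)
proof (induction k arbitrary: f g)
  case 0
  then show ?case by (auto intro: bounded_bilinear.continuous_on[OF assms(1)])
next
  case (Suc k)
  have D: "((\<lambda>x. mul (f x) (g x)) has_derivative
      (\<lambda>v. mul (f x) (frechet_derivative g (at x) v) + mul (frechet_derivative f (at x) v) (g x)))
      (at x)"
    if "x \<in> S" for x
    using Suc.prems that
    by (intro bounded_bilinear.FDERIV[OF assms(1)]) (simp_all add: frechet_derivative_works[symmetric])
  have "Ck_on k S (\<lambda>x. frechet_derivative (\<lambda>x. mul (f x) (g x)) (at x) v)" for v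
  proof (rule Ck_on_cong[OF assms(2)])
    show "Ck_on k S (\<lambda>x. mul (f x) (frechet_derivative g (at x) v) +
        mul (frechet_derivative f (at x) v) (g x))"
      using Suc.prems
      by (intro Ck_on_add[OF assms(2)] Suc.IH Ck_on_SucD[OF Suc.prems(1)] Ck_on_SucD[OF Suc.prems(2)])
        simp_all
    show "mul (f x) (frechet_derivative g (at x) v) + mul (frechet_derivative f (at x) v) (g x) =
      frechet_derivative (\<lambda>x. mul (f x) (g x)) (at x) v" if "x \<in> S" for x
      using frechet_derivative_at[OF D[OF that]] by metis
  qed
  then show ?case using D by (auto simp: differentiable_def)
qed

lemma Ck_on_bounded_linear:
  assumes "bounded_linear f"
  shows "Ck_on k S f"
proof (cases k)
  case 0
  then show ?thesis using assms by (simp add: linear_continuous_on)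
next
  case (Suc m)
  have D: "(f has_derivative f) (at x)" for x
    using assms by (rule bounded_linear_imp_has_derivative)
  then have "frechet_derivative f (at x) = f" for x
    using frechet_derivative_at by metis
  then show ?thesis using Suc D by (auto simp: differentiable_def intro: Ck_on_const)
qed

text \<open>
  The directional derivative of a composite is \<open>D g(f x) (D f(x) v)\<close>, where the direction itself
  depends on \<open>x\<close>; differentiability classes only speak of fixed directions. Expanding
  \<open>D f(x) v\<close> in the standard basis turns it into a sum of products of functions of class
  \<open>C\<^sup>k\<close>, to which the induction hypothesis and the product rule apply.
\<close>

lemma Ck_on_compose:
  fixes f :: "'e::euclidean_space \<Rightarrow> 'd::euclidean_space"
  assumes "open S" "open T" "f ` S \<subseteq> T" "Ck_on k S f" "Ck_on k T g"
  shows "Ck_on k S (\<lambda>x. g (f x))"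
  using assms(4,5)
proof (induction k arbitrary: g)
  case 0
  then show ?case using assms(3) by (auto intro: continuous_on_compose2)
next
  case (Suc k)
  have D: "((\<lambda>x. g (f x)) has_derivative
      (\<lambda>v. frechet_derivative g (at (f x)) (frechet_derivative f (at x) v))) (at x)"
    if "x \<in> S" for x
  proof (rule has_derivative_compose[where f = f and g = g])
    show "(f has_derivative frechet_derivative f (at x)) (at x)"
      using Suc.prems that by (simp add: frechet_derivative_works[symmetric])
    show "(g has_derivative frechet_derivative g (at (f x))) (at (f x))"
      using Suc.prems that assms(3) by (simp add: frechet_derivative_works[symmetric] image_subset_iff)
  qed
  have "Ck_on k S (\<lambda>x. frechet_derivative (\<lambda>x. g (f x)) (at x) v)" for v
  proof (rule Ck_on_cong[OF assms(1)])
    have "Ck_on k S (\<lambda>x. frechet_derivative f (at x) v \<bullet> b)" for b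
      using Suc.prems
      by (intro Ck_on_bilinear[OF bounded_bilinear_inner assms(1)] Ck_on_const) auto
    moreover have "Ck_on k S (\<lambda>x. frechet_derivative g (at (f x)) b)" for b
      using Suc.prems by (intro Suc.IH Ck_on_SucD[OF Suc.prems(1)]) simp
    ultimately show "Ck_on k S (\<lambda>x. \<Sum>b\<in>Basis. (frechet_derivative f (at x) v \<bullet> b) *\<^sub>R
        frechet_derivative g (at (f x)) b)"
      by (intro Ck_on_sum[OF assms(1)] Ck_on_bilinear[OF bounded_bilinear_scaleR assms(1)]) auto
    show "(\<Sum>b\<in>Basis. (frechet_derivative f (at x) v \<bullet> b) *\<^sub>R frechet_derivative g (at (f x)) b) =
      frechet_derivative (\<lambda>x. g (f x)) (at x) v" if "x \<in> S" for x
    proof -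
      have "linear (frechet_derivative g (at (f x)))"
        using Suc.prems that assms(3) by (intro linear_frechet_derivative) auto
      then have "(\<Sum>b\<in>Basis. (w \<bullet> b) *\<^sub>R frechet_derivative g (at (f x)) b) =
          frechet_derivative g (at (f x)) (\<Sum>b\<in>Basis. (w \<bullet> b) *\<^sub>R b)" for w
        by (simp only: linear_sum linear_scale)
      then show ?thesis
        using fun_cong[OF frechet_derivative_at[OF D[OF that]], of v]
        by (simp only: euclidean_representation)
    qed
  qed
  then show ?case using D by (auto simp: differentiable_def)
qed

section \<open>Bump functions\<close>

text \<open>
  The functions \<open>exp (- 1/t) / t\<^sup>m\<close>, extended by \<open>0\<close> to \<open>t \<le> 0\<close>. All exponents \<open>m\<close> are treated at
  once because the linear span of the whole family is closed under differentiation, which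
  makes smoothness of each member a simple induction.
\<close>

definition flat_exp :: "nat \<Rightarrow> real \<Rightarrow> real" where
  "flat_exp m t = (if t \<le> 0 then 0 else exp (- inverse t) * inverse t ^ m)"

lemma flat_exp_limit: "(flat_exp m \<longlongrightarrow> 0) (at 0)"
proof -
  have "((\<lambda>t::real. exp (- inverse t) * inverse t ^ m) \<longlongrightarrow> 0) (at_right 0)"
    using filterlim_compose[OF tendsto_power_div_exp_0[of m] filterlim_inverse_at_top_right]
    by (simp add: exp_minus divide_inverse mult.commute)
  then have "(flat_exp m \<longlongrightarrow> 0) (at_right 0)"
    by (rule Lim_transform_eventually) (auto simp: eventually_at_filter flat_exp_def)
  moreover have "(flat_exp m \<longlongrightarrow> 0) (at_left 0)"
    by (rule Lim_transform_eventually[OF tendsto_const]) (auto simp: eventually_at_filter flat_exp_def)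
  ultimately show ?thesis
    by (simp add: filterlim_split_at)
qed

lemma flat_exp_deriv:
  "(flat_exp m has_real_derivative (flat_exp (m + 2) t - real m * flat_exp (m + 1) t)) (at t)"
proof -
  consider "t < 0" | "t = 0" | "t > 0" by linarith
  then show ?thesis
  proof cases
    case 1
    have "(flat_exp m has_real_derivative 0) (at t)"
      by (rule has_field_derivative_transform_within_open[of "\<lambda>_. 0" _ _ "{..<0}"])
        (use 1 in \<open>auto simp: flat_exp_def\<close>)
    then show ?thesis using 1 by (simp add: flat_exp_def)
  next
    case 2
    have "(flat_exp m y - flat_exp m 0) / (y - 0) = flat_exp (m + 1) y" for y
      by (simp add: flat_exp_def field_simps)
    then show ?thesis
      using 2 flat_exp_limit[of "m + 1"]
      by (simp only: has_field_derivative_iff) (simp add: flat_exp_def[of _ 0])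
  next
    case 3
    have D: "((\<lambda>t. exp (- inverse t) * inverse t ^ m) has_real_derivative
        (exp (- inverse t) * inverse t ^ (m + 2) - real m * (exp (- inverse t) * inverse t ^ (m + 1)))) (at t)"
      using 3 by (auto intro!: derivative_eq_intros simp: power2_eq_square) (cases m; simp add: field_simps)
    have "(flat_exp m has_real_derivative
        (exp (- inverse t) * inverse t ^ (m + 2) - real m * (exp (- inverse t) * inverse t ^ (m + 1)))) (at t)"
      by (rule has_field_derivative_transform_within_open[OF D, of "{0<..}"])
        (use 3 in \<open>auto simp: flat_exp_def\<close>)
    then show ?thesis using 3 by (simp add: flat_exp_def)
  qed
qed

lemma Ck_on_flat_exp: "Ck_on k UNIV (flat_exp m)"
proof (induction k arbitrary: m)
  case 0
  show ?case
    using flat_exp_deriv by (auto intro!: continuous_at_imp_continuous_on DERIV_isCont)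
next
  case (Suc k)
  have D: "(flat_exp m has_derivative
      (\<lambda>v. (flat_exp (m + 2) t + (- real m) * flat_exp (m + 1) t) * v)) (at t)" for t
    using flat_exp_deriv[of m t] by (simp add: has_field_derivative_def)
  have "Ck_on k UNIV (\<lambda>t. (flat_exp (m + 2) t + (- real m) * flat_exp (m + 1) t) * v)" for v
    by (intro Ck_on_bilinear[OF bounded_bilinear_mult] Ck_on_add Ck_on_const Suc.IH open_UNIV)
  moreover have "frechet_derivative (flat_exp m) (at t) =
      (\<lambda>v. (flat_exp (m + 2) t + (- real m) * flat_exp (m + 1) t) * v)" for t
    using frechet_derivative_at[OF D] by simp
  ultimately show ?case using D by (auto simp: differentiable_def)
qed

text \<open>The function \<open>exp (- 1/t)\<close> at \<open>t = r\<^sup>2 - |x - x\<^sub>0|\<^sup>2\<close>, normalised at the centre of the ball.\<close>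

lemma exists_bump:
  fixes x0 :: "'e::euclidean_space"
  assumes "r > 0"
  obtains \<rho> :: "'e \<Rightarrow> real" where "smooth_on UNIV \<rho>" "\<rho> x0 = 1" "\<And>x. x \<notin> cball x0 r \<Longrightarrow> \<rho> x = 0"
proof -
  \<comment> \<open>The swapped arguments of the inner product supply the minus sign.\<close>
  define Q where "Q x = r\<^sup>2 + (x - x0) \<bullet> (x0 - x)" for x
  define \<rho> where "\<rho> x = flat_exp 0 (Q x) * inverse (flat_exp 0 (Q x0))" for x
  have Q: "Ck_on k UNIV Q" for k
  proof -
    have "Ck_on k UNIV (\<lambda>x::'e. r\<^sup>2 + (x + (- x0)) \<bullet> (x0 + (- x)))"
      by (intro Ck_on_bilinear[OF bounded_bilinear_inner] Ck_on_add Ck_on_const open_UNIV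
        Ck_on_bounded_linear bounded_linear_ident bounded_linear_minus[OF bounded_linear_ident])
    then show ?thesis by (simp add: Q_def[abs_def])
  qed
  have "smooth_on UNIV \<rho>"
    unfolding smooth_on_def \<rho>_def
    by (intro allI Ck_on_bilinear[OF bounded_bilinear_mult] Ck_on_const open_UNIV
      Ck_on_compose[OF open_UNIV open_UNIV _ Q Ck_on_flat_exp]) auto
  moreover have "\<rho> x0 = 1"
    using assms by (simp add: \<rho>_def Q_def flat_exp_def)
  moreover have "\<rho> x = 0" if "x \<notin> cball x0 r" for x
  proof -
    have "r\<^sup>2 \<le> (dist x0 x)\<^sup>2"
      using that assms by (intro power_mono) auto
    moreover have "Q x = r\<^sup>2 - (dist x0 x)\<^sup>2"
      by (simp add: Q_def dist_norm power2_norm_eq_inner algebra_simps inner_commute)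
    ultimately show ?thesis by (simp add: \<rho>_def flat_exp_def)
  qed
  ultimately show ?thesis by (rule that)
qed

section \<open>Charts and tangent vectors\<close>

locale smooth_manifold =
  fixes A :: "('a::{t2_space, second_countable_topology}, 'e::euclidean_space) atlas"
  assumes smooth_atlas: "smooth_atlas A"
begin

definition transition :: "('a, 'e) chart \<Rightarrow> ('a, 'e) chart \<Rightarrow> 'e \<Rightarrow> 'e" where
  "transition c d = snd d \<circ> inv_chart c"

definition overlap :: "('a, 'e) chart \<Rightarrow> ('a, 'e) chart \<Rightarrow> 'e set" where
  "overlap c d = snd c ` (fst c \<inter> fst d)"

lemma is_chart: "c \<in> A \<Longrightarrow> is_chart c"
  using smooth_atlas by (simp add: smooth_atlas_def)

lemma chart_at: "chart_at A p \<in> A" "p \<in> fst (chart_at A p)"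
proof -
  have "\<exists>c. c \<in> A \<and> p \<in> fst c"
    using smooth_atlas unfolding smooth_atlas_def by blast
  from someI_ex[OF this] show "chart_at A p \<in> A" "p \<in> fst (chart_at A p)"
    by (auto simp: chart_at_def)
qed

lemma open_chart_domain: "c \<in> A \<Longrightarrow> open (fst c)"
  and open_chart_image: "c \<in> A \<Longrightarrow> open (chart_image c)"
  using is_chart by (simp_all add: is_chart_def)

lemma continuous_on_chart: "c \<in> A \<Longrightarrow> continuous_on (fst c) (snd c)"
  and continuous_on_inv_chart: "c \<in> A \<Longrightarrow> continuous_on (chart_image c) (inv_chart c)"
  and inv_chart_chart: "c \<in> A \<Longrightarrow> q \<in> fst c \<Longrightarrow> inv_chart c (snd c q) = q"
  and chart_inv_chart: "c \<in> A \<Longrightarrow> y \<in> chart_image c \<Longrightarrow> snd c (inv_chart c y) = y"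
  using is_chart by (simp_all add: is_chart_def homeomorphism_def)

lemma inv_chart_in: "c \<in> A \<Longrightarrow> y \<in> chart_image c \<Longrightarrow> inv_chart c y \<in> fst c"
  by (auto simp: chart_image_def inv_chart_chart)

lemma overlap_eq: "c \<in> A \<Longrightarrow> overlap c d = chart_image c \<inter> inv_chart c -` fst d"
  using inv_chart_chart[of c] by (auto simp: overlap_def chart_image_def)

lemma open_overlap: "c \<in> A \<Longrightarrow> d \<in> A \<Longrightarrow> open (overlap c d)"
  by (simp only: overlap_eq, intro continuous_open_preimage continuous_on_inv_chart open_chart_image open_chart_domain)

lemma smooth_on_transition: "c \<in> A \<Longrightarrow> d \<in> A \<Longrightarrow> smooth_on (overlap c d) (transition c d)"
  using smooth_atlas by (simp add: smooth_atlas_def overlap_def transition_def)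

lemma smooth_on_imp_differentiable: "smooth_on S F \<Longrightarrow> x \<in> S \<Longrightarrow> F differentiable (at x)"
proof -
  assume "smooth_on S F" "x \<in> S"
  then have "Ck_on (Suc 0) S F" unfolding smooth_on_def by blast
  then show ?thesis using \<open>x \<in> S\<close> by simp
qed

lemma transition_differentiable:
  assumes "c \<in> A" "d \<in> A" "q \<in> fst c" "q \<in> fst d"
  shows "transition c d differentiable (at (snd c q))"
proof (rule smooth_on_imp_differentiable[OF smooth_on_transition[OF assms(1,2)]])
  show "snd c q \<in> overlap c d"
    using assms(3,4) by (auto simp: overlap_def)
qed

lemma transition_has_derivative:
  assumes "c \<in> A" "d \<in> A" "q \<in> fst c" "q \<in> fst d"
  shows "(transition c d has_derivative frechet_derivative (transition c d) (at (snd c q))) (at (snd c q))"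
  using transition_differentiable[OF assms] by (rule frechet_derivative_works[THEN iffD1])

lemma linear_frechet_transition:
  assumes "c \<in> A" "d \<in> A" "q \<in> fst c" "q \<in> fst d"
  shows "linear (frechet_derivative (transition c d) (at (snd c q)))"
  using transition_differentiable[OF assms] by (rule linear_frechet_derivative)

text \<open>
  Differentials and components are taken in the chart chosen at each point, which varies
  without regularity. This form of the chain rule is what carries pointwise information
  over to one fixed chart, where calculus is possible.
\<close>

lemma has_derivative_change_chart:
  assumes "c \<in> A" "d \<in> A" "q \<in> fst c" "q \<in> fst d"
    and "((F \<circ> inv_chart d) has_derivative D) (at (snd d q))"
  shows "((F \<circ> inv_chart c) has_derivative
    (\<lambda>v. D (frechet_derivative (transition c d) (at (snd c q)) v))) (at (snd c q))"
proof (rule has_derivative_transform_within_open[where t = UNIV])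
  have "transition c d (snd c q) = snd d q"
    using assms by (simp add: transition_def inv_chart_chart)
  then show "((\<lambda>x. (F \<circ> inv_chart d) (transition c d x)) has_derivative
    (\<lambda>v. D (frechet_derivative (transition c d) (at (snd c q)) v))) (at (snd c q))"
    using has_derivative_compose[OF transition_has_derivative[OF assms(1-4)], of "F \<circ> inv_chart d" D] assms(5)
    by simp
  show "open (overlap c d)" using assms open_overlap by blast
  show "snd c q \<in> overlap c d" using assms by (auto simp: overlap_def)
  show "(F \<circ> inv_chart d) (transition c d x) = (F \<circ> inv_chart c) x" if "x \<in> overlap c d" for x
    using that assms by (auto simp: overlap_def transition_def inv_chart_chart)
qed

lemma frechet_transition_comp:
  assumes "c \<in> A" "d \<in> A" "e \<in> A" "q \<in> fst c" "q \<in> fst d" "q \<in> fst e"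
  shows "frechet_derivative (transition d e) (at (snd d q))
      (frechet_derivative (transition c d) (at (snd c q)) v) =
    frechet_derivative (transition c e) (at (snd c q)) v"
proof -
  have "(transition c e has_derivative
    (\<lambda>v. frechet_derivative (transition d e) (at (snd d q))
      (frechet_derivative (transition c d) (at (snd c q)) v))) (at (snd c q))"
    using has_derivative_change_chart[OF assms(1,2,4,5), of "snd e"]
      transition_has_derivative[OF assms(2,3,5,6)]
    by (simp only: transition_def)
  from fun_cong[OF frechet_derivative_at[OF this], of v] show ?thesis .
qed

lemma frechet_transition_self:
  assumes "c \<in> A" "q \<in> fst c"
  shows "frechet_derivative (transition c c) (at (snd c q)) v = v"
proof -
  have "frechet_derivative (transition c c) (at (snd c q)) = frechet_derivative (\<lambda>x. x) (at (snd c q))"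
    using assms open_chart_image
    by (intro frechet_derivative_cong_open[of "chart_image c"])
      (auto simp: transition_def chart_inv_chart, auto simp: chart_image_def)
  then show ?thesis by simp
qed

lemma components_eq:
  "components A c q v = frechet_derivative (transition (chart_at A q) c) (at (snd (chart_at A q) q)) v"
  by (simp add: components_def transition_def)

text \<open>
  In a chart \<open>c\<^sub>0\<close> around \<open>p\<close>, take the field with constant components \<open>v\<close> multiplied by a bump
  function \<open>\<rho>\<close> whose support lies in a compact ball of the chart image, and extend it by zero.
  In any other chart it is smooth on the overlap with \<open>c\<^sub>0\<close>, and it vanishes off the image \<open>K\<close> of
  the ball in \<open>M\<close>. These two regions are open because \<open>K\<close>, being compact in a Hausdorff
  space, is closed; and they cover the chart.
\<close>

lemma vector_field_extension: "\<exists>X. vector_field A X \<and> X p = v"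
proof -
  define c0 where "c0 = chart_at A p"
  have c0: "c0 \<in> A" "p \<in> fst c0" using chart_at by (auto simp: c0_def)
  define x0 where "x0 = snd c0 p"
  have "x0 \<in> chart_image c0" using c0 by (simp add: x0_def chart_image_def)
  then obtain r where r: "r > 0" "cball x0 r \<subseteq> chart_image c0"
    using open_chart_image[OF c0(1)] open_contains_cball by blast
  obtain \<rho> :: "'e \<Rightarrow> real" where \<rho>: "smooth_on UNIV \<rho>" "\<rho> x0 = 1" "\<And>x. x \<notin> cball x0 r \<Longrightarrow> \<rho> x = 0"
    using exists_bump[OF r(1)] by blast
  define K where "K = inv_chart c0 ` cball x0 r"
  have "compact K"
    unfolding K_def using continuous_on_inv_chart[OF c0(1)] r(2)
    by (intro compact_continuous_image) (auto intro: continuous_on_subset)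
  then have "closed K" by (rule compact_imp_closed)
  have off_K: "\<rho> (snd c0 q) = 0" if "q \<in> fst c0" "q \<notin> K" for q
    using that \<rho>(3)[of "snd c0 q"] inv_chart_chart[OF c0(1)] unfolding K_def by force
  \<comment> \<open>The value at \<open>q\<close> must be given in the chart chosen at \<open>q\<close>, hence the transition derivative.\<close>
  define X where "X q = (if q \<in> fst c0 then \<rho> (snd c0 q) *\<^sub>R
    frechet_derivative (transition c0 (chart_at A q)) (at (snd c0 q)) v else 0)" for q
  have comp: "components A c q (X q) =
      \<rho> (snd c0 q) *\<^sub>R frechet_derivative (transition c0 c) (at (snd c0 q)) v"
    if "c \<in> A" "q \<in> fst c" "q \<in> fst c0" for c q
  proof -
    have "linear (frechet_derivative (transition (chart_at A q) c) (at (snd (chart_at A q) q)))"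
      using that chart_at by (intro linear_frechet_transition) auto
    then show ?thesis
      using that chart_at c0
      by (simp add: components_eq X_def linear_scale frechet_transition_comp)
  qed
  have comp0: "components A c q (X q) = 0" if "c \<in> A" "q \<in> fst c" "q \<notin> K" for c q
  proof (cases "q \<in> fst c0")
    case True
    then show ?thesis using comp[OF that(1,2)] off_K that by simp
  next
    case False
    have "linear (frechet_derivative (transition (chart_at A q) c) (at (snd (chart_at A q) q)))"
      using that chart_at by (intro linear_frechet_transition) auto
    then show ?thesis using False by (simp add: components_eq X_def linear_0)
  qed
  have "vector_field A X"
    unfolding vector_field_def
  proof
    fix c assume c: "c \<in> A"
    define S1 where "S1 = overlap c c0"
    define S2 where "S2 = chart_image c \<inter> inv_chart c -` (- K)"
    have S1: "open S1" using c c0 open_overlap by (simp add: S1_def)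
    have S2: "open S2"
      unfolding S2_def using \<open>closed K\<close> c
      by (intro continuous_open_preimage continuous_on_inv_chart open_chart_image) auto
    have "K \<subseteq> fst c0"
      using r(2) inv_chart_in[OF c0(1)] unfolding K_def by blast
    then have S12: "chart_image c = S1 \<union> S2"
      using c by (auto simp: S1_def S2_def overlap_eq)
    let ?F = "(\<lambda>q. components A c q (X q)) \<circ> inv_chart c"
    define W where "W x = \<rho> x *\<^sub>R frechet_derivative (transition c0 c) (at x) v" for x
    have 1: "Ck_on k S1 ?F" for k
    proof (rule Ck_on_cong[OF S1])
      have "Ck_on (Suc k) (overlap c0 c) (transition c0 c)"
        using smooth_on_transition[OF c0(1) c] unfolding smooth_on_def by blast
      then have "Ck_on k (overlap c0 c) (\<lambda>x. frechet_derivative (transition c0 c) (at x) v)"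
        by simp
      moreover have "Ck_on k (overlap c0 c) \<rho>"
        using \<rho>(1) Ck_on_subset unfolding smooth_on_def by blast
      ultimately have "Ck_on k (overlap c0 c) W"
        unfolding W_def
        by (intro Ck_on_bilinear[OF bounded_bilinear_scaleR] open_overlap c c0)
      moreover have "transition c c0 ` S1 \<subseteq> overlap c0 c"
        using c by (auto simp: S1_def overlap_def transition_def inv_chart_chart)
      moreover have "Ck_on k S1 (transition c c0)"
        using smooth_on_transition[OF c c0(1)] unfolding smooth_on_def S1_def by blast
      ultimately show "Ck_on k S1 (\<lambda>x. W (transition c c0 x))"
        using Ck_on_compose[OF S1 open_overlap[OF c0(1) c]] by blast
      show "W (transition c c0 x) = ?F x" if "x \<in> S1" for x
        using that c comp[OF c] inv_chart_in[OF c]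
        by (auto simp: S1_def overlap_eq W_def transition_def)
    qed
    have 2: "Ck_on k S2 ?F" for k
      by (rule Ck_on_cong[OF S2 _ Ck_on_const[of k S2 0]])
        (use comp0[OF c] inv_chart_in[OF c] in \<open>auto simp: S2_def\<close>)
    show "smooth_on (chart_image c) ?F"
      unfolding S12 smooth_on_def using Ck_on_Un[OF S1 S2 1 2] by blast
  qed
  moreover have "X p = v"
    using c0 \<rho>(2) frechet_transition_self[OF c0]
    by (simp add: X_def c0_def[symmetric] x0_def)
  ultimately show ?thesis by blast
qed

section \<open>Differentials of functions\<close>

text \<open>
  Differentials of products and differences are computed from differentiability, which
  passes to products and differences directly in the chart chosen at each point.
\<close>

definition differentiable_fun :: "('a \<Rightarrow> real) \<Rightarrow> bool" where
  "differentiable_fun F \<longleftrightarrow>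
     (\<forall>p. (F \<circ> inv_chart (chart_at A p)) differentiable (at (snd (chart_at A p) p)))"

lemma smooth_fun_differentiable:
  assumes "smooth_fun A F"
  shows "differentiable_fun F"
  unfolding differentiable_fun_def
proof
  fix p
  have "smooth_on (chart_image (chart_at A p)) (F \<circ> inv_chart (chart_at A p))"
    using assms chart_at by (simp add: smooth_fun_def)
  then show "(F \<circ> inv_chart (chart_at A p)) differentiable (at (snd (chart_at A p) p))"
    by (rule smooth_on_imp_differentiable) (simp add: chart_image_def chart_at)
qed

lemma differential_works:
  "differentiable_fun F \<Longrightarrow>
     ((F \<circ> inv_chart (chart_at A p)) has_derivative differential A F p) (at (snd (chart_at A p) p))"
  by (simp add: differentiable_fun_def differential_def[abs_def] frechet_derivative_works[symmetric])

lemma differential_unique: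
  assumes "((F \<circ> inv_chart (chart_at A p)) has_derivative D) (at (snd (chart_at A p) p))"
  shows "differential A F p v = D v"
  using frechet_derivative_at[OF assms] by (simp add: differential_def)

lemma linear_differential: "differentiable_fun F \<Longrightarrow> linear (differential A F p)"
  by (rule has_derivative_linear[OF differential_works])

lemma differential_const: "differential A (\<lambda>_. c) p v = 0"
  by (rule differential_unique) (simp add: comp_def)

lemma
  assumes "differentiable_fun F" "differentiable_fun G"
  shows differential_diff: "differential A (\<lambda>q. F q - G q) p v = differential A F p v - differential A G p v"
    and differential_mult: "differential A (\<lambda>q. F q * G q) p v = F p * differential A G p v + differential A F p v * G p"
    and differentiable_fun_diff: "differentiable_fun (\<lambda>q. F q - G q)"
    and differentiable_fun_mult: "differentiable_fun (\<lambda>q. F q * G q)"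
proof -
  have D: "((\<lambda>x. (F \<circ> inv_chart (chart_at A p)) x - (G \<circ> inv_chart (chart_at A p)) x) has_derivative
      (\<lambda>v. differential A F p v - differential A G p v)) (at (snd (chart_at A p) p))" for p
    using assms by (intro has_derivative_diff differential_works)
  have M: "((\<lambda>x. (F \<circ> inv_chart (chart_at A p)) x * (G \<circ> inv_chart (chart_at A p)) x) has_derivative
      (\<lambda>v. F p * differential A G p v + differential A F p v * G p)) (at (snd (chart_at A p) p))" for p
    using has_derivative_mult[OF differential_works[OF assms(1)] differential_works[OF assms(2)], of p]
    by (simp add: inv_chart_chart chart_at)
  show "differential A (\<lambda>q. F q - G q) p v = differential A F p v - differential A G p v"
    by (rule differential_unique) (use D in \<open>simp add: comp_def\<close>)
  show "differential A (\<lambda>q. F q * G q) p v = F p * differential A G p v + differential A F p v * G p"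
    by (rule differential_unique) (use M in \<open>simp add: comp_def\<close>)
  show "differentiable_fun (\<lambda>q. F q - G q)"
    unfolding differentiable_fun_def differentiable_def using D by (auto simp: comp_def)
  show "differentiable_fun (\<lambda>q. F q * G q)"
    unfolding differentiable_fun_def differentiable_def using M by (auto simp: comp_def)
qed

lemma smooth_fun_const: "smooth_fun A (\<lambda>_. c)"
  by (simp add: smooth_fun_def smooth_on_def comp_def Ck_on_const)

lemma differentiable_fun_const: "differentiable_fun (\<lambda>_. c)"
  by (rule smooth_fun_differentiable[OF smooth_fun_const])

lemma differential_cmult:
  assumes "differentiable_fun F"
  shows "differential A (\<lambda>q. c * F q) p v = c * differential A F p v"
  using differential_mult[OF differentiable_fun_const assms] by (simp add: differential_const)

text \<open>
  In one fixed chart all derivatives vanish by the chain rule, so the function is constant on a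
  coordinate ball; connectedness turns local constancy into constancy.
\<close>

lemma differential_zero_imp_constant:
  assumes "connected (UNIV :: 'a set)" "differentiable_fun F" "\<And>p v. differential A F p v = 0"
  shows "F p = F q"
proof (rule connected_local_const[OF assms(1)])
  show "\<forall>a\<in>UNIV. \<forall>\<^sub>F b in at a within UNIV. F a = F b"
  proof
    fix a
    define c where "c = chart_at A a"
    have c: "c \<in> A" "a \<in> fst c" using chart_at by (auto simp: c_def)
    have deriv0: "((F \<circ> inv_chart c) has_derivative (\<lambda>v. 0)) (at (snd c b))" if "b \<in> fst c" for b
      using has_derivative_change_chart[OF c(1) chart_at(1) that chart_at(2) differential_works[OF assms(2)]]
      by (simp add: assms(3))
    have "snd c a \<in> chart_image c" using c by (simp add: chart_image_def)
    then obtain r where r: "r > 0" "ball (snd c a) r \<subseteq> chart_image c"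
      using open_chart_image[OF c(1)] open_contains_ball by blast
    have const: "(F \<circ> inv_chart c) y = (F \<circ> inv_chart c) (snd c a)" if "y \<in> ball (snd c a) r" for y
    proof (rule has_derivative_zero_unique[of "ball (snd c a) r"])
      show "(F \<circ> inv_chart c has_derivative (\<lambda>h. 0)) (at x within ball (snd c a) r)"
        if "x \<in> ball (snd c a) r" for x
      proof -
        have "x \<in> chart_image c" using that r by auto
        then show ?thesis
          using deriv0[OF inv_chart_in[OF c(1)]] chart_inv_chart[OF c(1)] has_derivative_at_withinI
          by metis
      qed
    qed (use that r in auto)
    have "open (fst c \<inter> snd c -` ball (snd c a) r)"
      by (intro continuous_open_preimage continuous_on_chart open_chart_domain c open_ball)
    then have "\<forall>\<^sub>F b in at a. b \<in> fst c \<inter> snd c -` ball (snd c a) r"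
      using c r by (intro eventually_at_in_open') auto
    then show "\<forall>\<^sub>F b in at a. F a = F b"
    proof (rule eventually_mono)
      fix b assume "b \<in> fst c \<inter> snd c -` ball (snd c a) r"
      then show "F a = F b"
        using const[of "snd c b"] c by (simp add: inv_chart_chart)
    qed
  qed
qed auto

section \<open>Parallel symmetric tensors in the presence of a torse-forming field\<close>

lemma differential_parallel:
  assumes "parallel_02 A nabla h" "vector_field A X" "vector_field A Y" "vector_field A Z"
  shows "differential A (\<lambda>q. h q (Y q) (Z q)) p (X p) =
    h p (nabla X Y p) (Z p) + h p (Y p) (nabla X Z p)"
proof -
  have "covariant_derivative_02 A nabla h X Y Z p = 0"
    using assms unfolding parallel_02_def by blast
  then show ?thesis by (simp add: covariant_derivative_02_def)
qed

text \<open>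
  The argument described at the beginning, for a torse-forming field of constant nonzero
  length. For \<open>\<theta> = k \<xi>\<close> the regularity condition takes this form because \<open>k df(\<xi>) = \<theta>(f)\<close>.
\<close>

theorem parallel_tensor_multiple_of_metric:
  assumes connected: "connected (UNIV :: 'a set)"
    and g: "tensor_field_02 A g" "symmetric_02 g" and LC: "levi_civita A g nabla"
    and torse: "torse_forming A nabla \<theta> f \<gamma>"
    and length: "\<And>p. g p (\<theta> p) (\<theta> p) = N" "N \<noteq> 0"
    and regular: "\<And>p. differential A f p (\<theta> p) + (f p)\<^sup>2 \<noteq> 0"
    and h: "tensor_field_02 A h" "symmetric_02 h" "parallel_02 A nabla h"
  shows "\<exists>c::real. \<forall>p u v. h p u v = c * g p u v"
proof -
  have g_par: "parallel_02 A nabla g" and conn: "connection A nabla"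
    and torsion: "torsion_free A nabla"
    using LC by (simp_all add: levi_civita_def)
  have \<theta>: "vector_field A \<theta>" and f: "differentiable_fun f"
    and nabla_\<theta>: "\<And>X p. vector_field A X \<Longrightarrow> nabla X \<theta> p = f p *\<^sub>R X p + \<gamma> p (X p) *\<^sub>R \<theta> p"
    using torse smooth_fun_differentiable by (simp_all add: torse_forming_def)
  have nabla_field: "vector_field A (nabla X Y)" if "vector_field A X" "vector_field A Y" for X Y
    using conn that by (simp add: connection_def)
  have g_sym: "g p u v = g p v u" and h_sym: "h p u v = h p v u" for p u v
    using g h by (auto simp: symmetric_02_def)
  have bil: "bilinear (g p)" "bilinear (h p)" for p
    using g h by (simp_all add: tensor_field_02_def)
  note bil_simps = bilinear_ladd[OF bil(1)] bilinear_radd[OF bil(1)]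
    bilinear_lmul[OF bil(1)] bilinear_rmul[OF bil(1)] bilinear_lsub[OF bil(1)]
    bilinear_ladd[OF bil(2)] bilinear_radd[OF bil(2)]
    bilinear_lmul[OF bil(2)] bilinear_rmul[OF bil(2)] bilinear_lsub[OF bil(2)]
  have diffbl: "differentiable_fun (\<lambda>q. g q (X q) (Y q))" "differentiable_fun (\<lambda>q. h q (X q) (Y q))"
    if "vector_field A X" "vector_field A Y" for X Y
    using g h that by (auto simp: tensor_field_02_def intro!: smooth_fun_differentiable)
  have deriv_g: "differential A (\<lambda>q. g q (Y q) (Z q)) p (X p) =
      g p (nabla X Y p) (Z p) + g p (Y p) (nabla X Z p)"
    and deriv_h: "differential A (\<lambda>q. h q (Y q) (Z q)) p (X p) =
      h p (nabla X Y p) (Z p) + h p (Y p) (nabla X Z p)"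
    if "vector_field A X" "vector_field A Y" "vector_field A Z" for X Y Z p
    using g_par h(3) that by (auto intro: differential_parallel)

  define s where "s p = h p (\<theta> p) (\<theta> p)" for p
  define B where "B p v = N * h p v (\<theta> p) - s p * g p v (\<theta> p)" for p v
  have s_smooth: "smooth_fun A s"
    using h(1) \<theta> by (simp add: tensor_field_02_def s_def[abs_def])
  note s = smooth_fun_differentiable[OF s_smooth]
  have B_theta: "B p (\<theta> p) = 0" for p
    by (simp add: B_def s_def length)
  have \<gamma>: "N * \<gamma> p (X p) = - f p * g p (X p) (\<theta> p)" if X: "vector_field A X" for X p
  proof -
    have "0 = 2 * g p (nabla X \<theta> p) (\<theta> p)"
      using deriv_g[OF X \<theta> \<theta>, of p] g_sym[of p "\<theta> p" "nabla X \<theta> p"]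
      by (simp add: length differential_const)
    then have "2 * (f p * g p (X p) (\<theta> p)) + 2 * (N * \<gamma> p (X p)) = 0"
      by (simp add: nabla_\<theta>[OF X] bil_simps length mult.commute)
    then show ?thesis by linarith
  qed
  have ds: "differential A s p (X p) = 2 / N * (f p * B p (X p))" if X: "vector_field A X" for X p
  proof -
    have "differential A s p (X p) = 2 * h p (nabla X \<theta> p) (\<theta> p)"
      using deriv_h[OF X \<theta> \<theta>, of p] h_sym[of p "\<theta> p" "nabla X \<theta> p"]
      by (simp add: s_def[abs_def])
    then have "N * differential A s p (X p) =
        2 * (f p * N * h p (X p) (\<theta> p) + (N * \<gamma> p (X p)) * s p)"
      by (simp add: nabla_\<theta>[OF X] bil_simps s_def algebra_simps)
    then have "N * differential A s p (X p) = 2 * (f p * B p (X p))"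
      by (simp add: \<gamma>[OF X] B_def algebra_simps)
    then show ?thesis using length(2) by (simp add: field_simps)
  qed
  have \<gamma>_theta: "\<gamma> p (\<theta> p) = - f p" for p
  proof -
    have "N * \<gamma> p (\<theta> p) = N * (- f p)"
      using \<gamma>[OF \<theta>, of p] by (simp add: length(1) mult.commute)
    then show ?thesis using length(2) mult_left_cancel by blast
  qed
  have nabla_theta_theta: "nabla \<theta> \<theta> p = 0" for p
    by (simp add: nabla_\<theta>[OF \<theta>] \<gamma>_theta)
  have s_theta: "differential A s p (\<theta> p) = 0" for p
    by (simp add: ds[OF \<theta>] B_theta)
  have B_field: "differentiable_fun (\<lambda>q. B q (Y q))" if "vector_field A Y" for Y
    unfolding B_def
    by (intro differentiable_fun_diff differentiable_fun_mult differentiable_fun_const s diffbl that \<theta>)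
  have dB: "differential A (\<lambda>q. B q (Y q)) p (X p) =
      N * (h p (nabla X Y p) (\<theta> p) + h p (Y p) (nabla X \<theta> p)) -
      (s p * (g p (nabla X Y p) (\<theta> p) + g p (Y p) (nabla X \<theta> p)) +
       differential A s p (X p) * g p (Y p) (\<theta> p))"
    if "vector_field A X" "vector_field A Y" for X Y p
    unfolding B_def
    by (simp add: differential_diff differential_mult differential_const
      differentiable_fun_mult differentiable_fun_const s diffbl that \<theta> deriv_g deriv_h)

  \<comment> \<open>Apply torsion-freeness to the function \<open>s\<close> and the fields \<open>\<theta>\<close> and \<open>Y\<close>.\<close>
  have B_zero: "B p v = 0" for p v
  proof -
    obtain Y where Y: "vector_field A Y" "Y p = v"
      using vector_field_extension by blast
    define Z where "Z q = nabla \<theta> Y q - nabla Y \<theta> q" for q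
    have "is_lie_bracket A \<theta> Y Z"
      using torsion \<theta> Y by (simp add: torsion_free_def Z_def[abs_def])
    then have Z: "vector_field A Z"
      and bracket: "differential A s p (Z p) =
        differential A (\<lambda>q. differential A s q (Y q)) p (\<theta> p) -
        differential A (\<lambda>q. differential A s q (\<theta> q)) p (Y p)"
      using s_smooth by (simp_all add: is_lie_bracket_def)
    have "differential A (\<lambda>q. differential A s q (Y q)) p (\<theta> p) =
        2 / N * (f p * B p (nabla \<theta> Y p) + differential A f p (\<theta> p) * B p v)"
    proof -
      have "differential A (\<lambda>q. B q (Y q)) p (\<theta> p) = B p (nabla \<theta> Y p)"
        unfolding dB[OF \<theta> Y(1)] nabla_theta_theta
        using bilinear_rzero[OF bil(1)] bilinear_rzero[OF bil(2)]
        by (simp add: s_theta B_def)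
      then show ?thesis
        by (simp only: ds[OF Y(1)] differential_cmult differentiable_fun_mult
          differential_mult f B_field Y)
    qed
    moreover have "differential A (\<lambda>q. differential A s q (\<theta> q)) p (Y p) = 0"
      by (simp add: s_theta differential_const)
    moreover have "B p (Z p) = B p (nabla \<theta> Y p) - f p * B p v"
    proof -
      have "B p (Z p) = B p (nabla \<theta> Y p) - f p * B p v - \<gamma> p v * B p (\<theta> p)"
        by (simp add: Z_def nabla_\<theta>[OF Y(1)] Y(2) B_def bil_simps algebra_simps)
      then show ?thesis by (simp add: B_theta)
    qed
    ultimately have "2 / N * (f p * (B p (nabla \<theta> Y p) - f p * B p v)) =
        2 / N * (f p * B p (nabla \<theta> Y p) + differential A f p (\<theta> p) * B p v)"
      using bracket ds[OF Z, of p] by simp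
    then have "f p * (B p (nabla \<theta> Y p) - f p * B p v) =
        f p * B p (nabla \<theta> Y p) + differential A f p (\<theta> p) * B p v"
      using length(2) by simp
    then have "(differential A f p (\<theta> p) + (f p)\<^sup>2) * B p v = 0"
      by (simp add: algebra_simps power2_eq_square)
    then show ?thesis using regular by simp
  qed

  have ds_zero: "differential A s p v = 0" for p v
    using ds vector_field_extension[of p v] B_zero by auto
  define T where "T p u v = N * h p u v - s p * g p u v" for p u v
  \<comment> \<open>The derivative of the identity \<open>B(Y) = 0\<close> along \<open>X\<close>.\<close>
  have f_T: "f p * T p (Y p) (X p) = 0" if X: "vector_field A X" and Y: "vector_field A Y" for X Y p
  proof -
    have "N * (h p (nabla X Y p) (\<theta> p) + h p (Y p) (nabla X \<theta> p)) -
        s p * (g p (nabla X Y p) (\<theta> p) + g p (Y p) (nabla X \<theta> p)) = 0"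
      using dB[OF X Y, of p] by (simp add: B_zero ds_zero differential_const)
    then have "B p (nabla X Y p) + f p * T p (Y p) (X p) + \<gamma> p (X p) * B p (Y p) = 0"
      by (simp add: nabla_\<theta>[OF X] B_def T_def bil_simps algebra_simps)
    then show ?thesis by (simp add: B_zero)
  qed
  have T_zero: "T p u v = 0" for p u v
  proof (cases "f p = 0")
    case False
    obtain X Y where "vector_field A X" "X p = v" "vector_field A Y" "Y p = u"
      using vector_field_extension by metis
    then show ?thesis using f_T[of X Y p] False by simp
  next
    case True
    obtain X Y where XY: "vector_field A X" "X p = v" "vector_field A Y" "Y p = u"
      using vector_field_extension by metis
    have T: "differentiable_fun (\<lambda>q. T q (Y q) (X q))"
      unfolding T_def
      by (intro differentiable_fun_diff differentiable_fun_mult differentiable_fun_const s diffbl XY)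
    \<comment> \<open>At a zero of \<open>f\<close> the product rule for \<open>f T = 0\<close> leaves only \<open>\<theta>(f) T\<close>.\<close>
    have "differential A (\<lambda>q. f q * T q (Y q) (X q)) p (\<theta> p) = 0"
      by (simp add: f_T[OF XY(1,3)] differential_const)
    then have "differential A f p (\<theta> p) * T p u v = 0"
      using True XY by (simp add: differential_mult[OF f T])
    then show ?thesis using regular[of p] True by simp
  qed
  \<comment> \<open>Any point at which to read off the constant value of \<open>s\<close>.\<close>
  define p\<^sub>0 :: 'a where "p\<^sub>0 = undefined"
  have "s p = s p\<^sub>0" for p
    by (rule differential_zero_imp_constant[OF connected s ds_zero])
  then have "h p u v = s p\<^sub>0 / N * g p u v" for p u v
    using T_zero[of p u v] length(2) by (simp add: T_def field_simps)
  then show ?thesis by blast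
qed

end

text \<open>
  The Reeb field is a unit field: \<open>\<phi> \<xi> = 0\<close> in the B-metric identity gives \<open>0 = - g(\<xi>, \<xi>) + 1\<close>.
  Hence \<open>k \<xi>\<close> has constant length \<open>k\<^sup>2 \<noteq> 0\<close>.
\<close>

theorem theorem4p1:
  fixes A :: "('a::{t2_space, second_countable_topology}, 'e::euclidean_space) atlas"
    and n :: nat
    and \<phi> :: "'a \<Rightarrow> 'e \<Rightarrow> 'e" and \<xi> :: "'a \<Rightarrow> 'e" and \<eta> :: "'a \<Rightarrow> 'e \<Rightarrow> real"
    and g :: "'a \<Rightarrow> 'e \<Rightarrow> 'e \<Rightarrow> real"
    and nabla :: "('a \<Rightarrow> 'e) \<Rightarrow> ('a \<Rightarrow> 'e) \<Rightarrow> 'a \<Rightarrow> 'e"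
    and \<theta> :: "'a \<Rightarrow> 'e" and f :: "'a \<Rightarrow> real" and \<gamma> :: "'a \<Rightarrow> 'e \<Rightarrow> real" and k :: real
    and h :: "'a \<Rightarrow> 'e \<Rightarrow> 'e \<Rightarrow> real"
  assumes "almost_contact_B_metric_manifold A n \<phi> \<xi> \<eta> g"
    and "connected (UNIV :: 'a set)"
    and "levi_civita A g nabla"
    and "torse_forming A nabla \<theta> f \<gamma>"
    and "constant_length_vertical \<xi> \<theta> k"
    and "regular_tf A \<xi> f k"
    and "tensor_field_02 A h" and "symmetric_02 h" and "parallel_02 A nabla h"
  shows "\<exists>c::real. \<forall>p u v. h p u v = c * g p u v"
proof -
  interpret smooth_manifold A
    using assms(1) by unfold_locales (simp add: almost_contact_B_metric_manifold_def)
  have g: "tensor_field_02 A g" "symmetric_02 g"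
    using assms(1) by (simp_all add: almost_contact_B_metric_manifold_def pseudo_riemannian_metric_def)
  have k: "k \<noteq> 0" and \<theta>: "\<And>p. \<theta> p = k *\<^sub>R \<xi> p"
    using assms(5) by (simp_all add: constant_length_vertical_def)
  have bil: "bilinear (g p)" for p
    using g by (simp add: tensor_field_02_def)
  have "g p (\<xi> p) (\<xi> p) = 1" for p
  proof -
    have "g p (\<phi> p (\<xi> p)) (\<phi> p (\<xi> p)) = - g p (\<xi> p) (\<xi> p) + \<eta> p (\<xi> p) * \<eta> p (\<xi> p)"
      and "\<phi> p (\<xi> p) = 0" and "\<eta> p (\<xi> p) = 1"
      using assms(1) unfolding almost_contact_B_metric_manifold_def by blast+
    then show ?thesis by (simp add: bilinear_lzero[OF bil])
  qed
  then have length: "g p (\<theta> p) (\<theta> p) = k\<^sup>2" for p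
    by (simp add: \<theta> bilinear_lmul[OF bil] bilinear_rmul[OF bil] power2_eq_square)
  have "linear (differential A f p)" for p
    using assms(4) by (auto simp: torse_forming_def intro: linear_differential smooth_fun_differentiable)
  then have "differential A f p (\<theta> p) = k * differential A f p (\<xi> p)" for p
    by (simp add: \<theta> linear_scale)
  then have regular: "differential A f p (\<theta> p) + (f p)\<^sup>2 \<noteq> 0" for p
    using assms(6) by (simp add: regular_tf_def)
  show ?thesis
    by (rule parallel_tensor_multiple_of_metric[OF assms(2) g assms(3,4) length _ regular assms(7-9)])
      (use k in simp)
qed

end
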